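(* Let $m$ be an even positive integer and let $D_{2m}=\langle u,v : u^m=e=v^2,\ vu=u^{m-1}v\rangle$. If $S\subseteq D_{2m}\setminus\{e\}$ with $|S|=2m-2$, then $D_{2m}$ has an $S$-sequencing.
   Context: For a group $G$ with identity $e$ and a set $S\subseteq G\setminus\{e\}$ with $|S|=k$, an $S$-sequencing of $G$ is an ordering $(g_1,\dots,g_k)$ of the elements of $S$ (each used exactly once) such that the partial products $h_0=e$, $h_i=g_1g_2\cdots g_i$ ($1\le i\le k$) are pairwise distinct. *)

theory Defs
  imports "HOL-Algebra.Group"
begin

text \<open>Concrete model of the dihedral group D_{2m} of order 2m.
  The pair (i, j) with i < m, j < 2 represents u^i v^j.
  Using v u = u^{-1} v:  (u^a v^b)(u^c v^d) = u^(a + (-1)^b c) v^(b+d).\<close>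

definition dihedral :: "nat \<Rightarrow> (nat \<times> nat) monoid" where
  "dihedral m = \<lparr> carrier = {0..<m} \<times> {0..<2},
     mult = (\<lambda>(a, b) (c, d).
               ((a + (if b = 0 then c else m - c)) mod m, (b + d) mod 2)),
     one = (0, 0) \<rparr>"

definition dih_u :: "nat \<times> nat" where "dih_u = (1, 0)"
definition dih_v :: "nat \<times> nat" where "dih_v = (0, 1)"

definition partial_prod :: "('a, 'b) monoid_scheme \<Rightarrow> 'a list \<Rightarrow> nat \<Rightarrow> 'a" where
  "partial_prod G gs i = foldl (\<lambda>x y. x \<otimes>\<^bsub>G\<^esub> y) \<one>\<^bsub>G\<^esub> (take i gs)"

definition is_S_sequencing :: "('a, 'b) monoid_scheme \<Rightarrow> 'a set \<Rightarrow> 'a list \<Rightarrow> bool" where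
  "is_S_sequencing G S gs \<longleftrightarrow>
     distinct gs \<and> set gs = S \<and> inj_on (partial_prod G gs) {0..length gs}"

definition has_S_sequencing :: "('a, 'b) monoid_scheme \<Rightarrow> 'a set \<Rightarrow> bool" where
  "has_S_sequencing G S \<longleftrightarrow> (\<exists>gs. is_S_sequencing G S gs)"

end

theory Submission
  imports Defs
begin

text \<open>The idea is that \<open>D\<^bsub>2m\<^esub>\<close> with \<open>m\<close> even is R-sequenceable: there is a cyclic arrangement
  of all but one of its elements whose consecutive quotients \<open>x\<^sup>-\<^sup>1y\<close> run through every
  non-identity element exactly once.  Cutting such a cycle open at the quotient that \<open>S\<close> omits
  and translating its first vertex to the identity gives an \<open>S\<close>-sequencing.

  With \<open>m = 2n\<close> the cycle runs backwards through the zigzag \<open>0, n, 1, n - 1, \<dots>\<close> of rotations,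
  then alternates between reflections with increasing and rotations with decreasing exponents, and
  finally runs through the zigzag \<open>n, 2n - 1, n + 1, 2n - 2, \<dots>\<close> of reflections.  The zigzag steps
  contribute all rotations.  A step between \<open>u\<^sup>a\<close> and \<open>u\<^sup>bv\<close>, in either direction,
  is \<open>u\<^bsup>b-a\<^esup>v\<close>, so the alternating part runs through the reflections in order; the single
  exponent skipped there, caused by the vertex \<open>u\<^bsup>n div 2\<^esup>v\<close> left out of the cycle, is
  supplied by the edge that closes the cycle.\<close>

section \<open>The model is a group\<close>

lemma carrier_dihedral: "carrier (dihedral m) = {0..<m} \<times> {0..<2}"
  and one_dihedral: "\<one>\<^bsub>dihedral m\<^esub> = (0, 0)"
  and mult_dihedral: "(a, b) \<otimes>\<^bsub>dihedral m\<^esub> (c, d) =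
    ((a + (if b = 0 then c else m - c)) mod m, (b + d) mod 2)"
  by (simp_all add: dihedral_def)

lemma fst_mult_dihedral_int:
  assumes "c < m"
  shows "int ((a + (if b = 0 then c else m - c)) mod m) =
    (int a + (if b = 0 then int c else - int c)) mod int m"
proof (cases "b = 0")
  case False
  have "int ((a + (m - c)) mod m) = (int a - int c + int m) mod int m"
    using assms by (simp add: zmod_int of_nat_diff algebra_simps)
  with False show ?thesis by simp
qed (simp add: zmod_int)

lemma group_dihedral:
  assumes "m > 0"
  shows "group (dihedral m)"
proof (rule groupI)
  fix x y z
  assume "x \<in> carrier (dihedral m)" "y \<in> carrier (dihedral m)" "z \<in> carrier (dihedral m)"
  then obtain a b c d e f where
    xyz: "x = (a, b)" "y = (c, d)" "z = (e, f)" and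
    bounds: "a < m" "c < m" "e < m" and "b < 2" "d < 2" "f < 2"
    by (auto simp: carrier_dihedral)
  then have bd: "b = 0 \<or> b = 1" "d = 0 \<or> d = 1" by auto
  \<comment> \<open>Over the integers conjugation by a reflection is the sign \<open>s\<close>;
    associativity then comes down to \<open>s\<close> being multiplicative.\<close>
  define s :: "nat \<Rightarrow> int" where "s = (\<lambda>b. if b = 0 then 1 else - 1)"
  define g :: "nat \<Rightarrow> nat \<Rightarrow> nat \<Rightarrow> nat"
    where "g = (\<lambda>a b c. (a + (if b = 0 then c else m - c)) mod m)"
  have g: "int (g a b c) = (int a + s b * int c) mod int m" if "c < m" for a b c
    using fst_mult_dihedral_int[OF that, of a b] by (simp add: g_def s_def)
  have "int (g (g a b c) ((b + d) mod 2) e) =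
      (int a + s b * int c + s ((b + d) mod 2) * int e) mod int m"
    using bounds by (simp add: g mod_simps)
  also have "s ((b + d) mod 2) = s b * s d"
    using bd by (auto simp: s_def)
  also have "(int a + s b * int c + s b * s d * int e) mod int m = int (g a b (g c d e))"
  proof -
    have "g c d e < m" using assms by (simp add: g_def)
    then have "int (g a b (g c d e)) = (int a + s b * ((int c + s d * int e) mod int m)) mod int m"
      using bounds by (simp add: g)
    also have "\<dots> = (int a + s b * (int c + s d * int e)) mod int m"
      by (metis mod_add_right_eq mod_mult_right_eq)
    finally show ?thesis by (simp add: algebra_simps)
  qed
  finally have "g (g a b c) ((b + d) mod 2) e = g a b (g c d e)" by simp
  moreover have "((b + d) mod 2 + f) mod 2 = (b + (d + f) mod 2) mod 2" for f
    by (simp add: mod_simps add.assoc)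
  ultimately show "x \<otimes>\<^bsub>dihedral m\<^esub> y \<otimes>\<^bsub>dihedral m\<^esub> z = x \<otimes>\<^bsub>dihedral m\<^esub> (y \<otimes>\<^bsub>dihedral m\<^esub> z)"
    by (simp only: xyz mult_dihedral g_def)
next
  fix x assume "x \<in> carrier (dihedral m)"
  then obtain a b where x: "x = (a, b)" "a < m" "b < 2"
    by (auto simp: carrier_dihedral)
  show "\<exists>y\<in>carrier (dihedral m). y \<otimes>\<^bsub>dihedral m\<^esub> x = \<one>\<^bsub>dihedral m\<^esub>"
  proof (cases "b = 0")
    case True
    then show ?thesis using x assms
      by (intro bexI[of _ "((m - a) mod m, 0)"])
        (auto simp: carrier_dihedral mult_dihedral one_dihedral mod_simps)
  next
    case False
    then show ?thesis using x
      by (intro bexI[of _ x])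
        (auto simp: carrier_dihedral mult_dihedral one_dihedral mod_simps)
  qed
qed (use assms in \<open>auto simp: carrier_dihedral mult_dihedral one_dihedral\<close>)

section \<open>Cutting a cycle open\<close>

lemma (in group) partial_prod_cycle:
  assumes v: "\<And>i. v i \<in> carrier G" and "k \<le> l"
  shows "partial_prod G (map (\<lambda>i. inv (v i) \<otimes> v (Suc i)) [0..<l]) k = inv (v 0) \<otimes> v k"
  using \<open>k \<le> l\<close>
proof (induction k)
  case 0
  then show ?case by (simp add: partial_prod_def v)
next
  case (Suc k)
  have "inv (v 0) \<otimes> v k \<otimes> (inv (v k) \<otimes> v (Suc k)) = inv (v 0) \<otimes> v (Suc k)"
  proof -
    have "v k \<otimes> (inv (v k) \<otimes> v (Suc k)) = v (Suc k)"
      by (metis v m_assoc inv_closed r_inv l_one)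
    then show ?thesis using v by (simp add: m_assoc)
  qed
  with Suc show ?case
    by (simp add: partial_prod_def take_map[symmetric] take_Suc_conv_app_nth)
qed

text \<open>Indices are reduced mod \<open>N\<close> so that step \<open>N - 1\<close> is the
  closing edge.\<close>

definition cycle_step :: "('a, 'b) monoid_scheme \<Rightarrow> nat \<Rightarrow> (nat \<Rightarrow> 'a) \<Rightarrow> nat \<Rightarrow> 'a" where
  "cycle_step G N w i = inv\<^bsub>G\<^esub> (w (i mod N)) \<otimes>\<^bsub>G\<^esub> w (Suc i mod N)"

text \<open>By counting, \<open>N\<close> steps that cover the \<open>N\<close> non-identity
  elements take each value once, and \<open>S\<close> omits exactly one of these values.\<close>

lemma (in group) has_S_sequencing_if_R_sequencing:
  assumes fin: "finite (carrier G)" and N: "Suc N = card (carrier G)"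
    and w: "\<And>i. i < N \<Longrightarrow> w i \<in> carrier G" and inj: "inj_on w {..<N}"
    and surj: "carrier G - {\<one>} \<subseteq> cycle_step G N w ` {..<N}"
    and S: "S \<subseteq> carrier G - {\<one>}" "Suc (card S) = N"
  shows "has_S_sequencing G S"
proof -
  let ?E = "carrier G - {\<one>}"
  have "finite ?E" and cardE: "card ?E = N"
    using fin N by (simp_all add: card_Diff_singleton flip: N)
  have img: "cycle_step G N w ` {..<N} = ?E"
    using surj \<open>finite ?E\<close> cardE card_image_le[of "{..<N}" "cycle_step G N w"]
    by (metis card_lessThan card_seteq finite_imageI finite_lessThan)
  then have inj_step: "inj_on (cycle_step G N w) {..<N}"
    by (simp add: eq_card_imp_inj_on cardE)
  have "card (?E - S) = 1"
    using S \<open>finite ?E\<close> cardE by (subst card_Diff_subset) (auto dest: finite_subset)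
  then obtain x where x: "?E - S = {x}"
    by (auto simp: card_1_singleton_iff)
  with img obtain p where p: "p < N" "cycle_step G N w p = x"
    by (metis Diff_iff imageE insertI1 lessThan_iff)
  \<comment> \<open>Starting just after the omitted step \<open>p\<close> makes it the last one, at
    index \<open>N - 1\<close>, where \<open>gs\<close> has already stopped.\<close>
  define v where "v = (\<lambda>i. w ((Suc p + i) mod N))"
  define gs where "gs = map (\<lambda>i. inv (v i) \<otimes> v (Suc i)) [0..<N - 1]"
  define \<sigma> where "\<sigma> = (\<lambda>i. (Suc p + i) mod N)"
  have "N > 0" using p by simp
  have v: "v i \<in> carrier G" for i
    unfolding v_def using w \<open>N > 0\<close> by simp
  have inj_\<sigma>: "inj_on \<sigma> {..<N}"
  proof (rule linorder_inj_onI)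
    fix i j assume ij: "i < j" "i \<in> {..<N}" "j \<in> {..<N}"
    then have "\<not> N dvd (Suc p + j) - (Suc p + i)"
      by (auto dest: dvd_imp_le)
    with ij show "\<sigma> i \<noteq> \<sigma> j"
      using mod_eq_dvd_iff_nat[of "Suc p + i" "Suc p + j" N] by (auto simp: \<sigma>_def)
  qed auto
  have \<sigma>_less: "\<sigma> i < N" for i
    using \<open>N > 0\<close> by (simp add: \<sigma>_def)
  have \<sigma>_last: "\<sigma> (N - 1) = p"
    using p by (simp add: \<sigma>_def)
  have gs: "gs = map (cycle_step G N w \<circ> \<sigma>) [0..<N - 1]"
    by (auto simp: gs_def v_def cycle_step_def \<sigma>_def mod_simps)
  have inj_gs: "inj_on (cycle_step G N w \<circ> \<sigma>) {..<N}"
    using inj_\<sigma> inj_step \<sigma>_less by (intro comp_inj_on) (auto elim: inj_on_subset)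
  have "\<sigma> ` {..<N} = {..<N}"
    using \<sigma>_less inj_\<sigma> by (intro endo_inj_surj) auto
  then have "(cycle_step G N w \<circ> \<sigma>) ` {..<N} = ?E"
    using img by (metis image_comp)
  moreover have "{..<N} = insert (N - 1) {..<N - 1}"
    using \<open>N > 0\<close> by auto
  moreover have "(cycle_step G N w \<circ> \<sigma>) (N - 1) = x"
    using p \<sigma>_last by simp
  ultimately have "(cycle_step G N w \<circ> \<sigma>) ` {..<N - 1} = ?E - {x}"
    using inj_gs by (auto simp: inj_on_def)
  moreover have "?E - {x} = S"
    using x S by blast
  ultimately have "set gs = S"
    by (simp add: gs atLeast0LessThan)
  moreover have "distinct gs"
    unfolding gs distinct_map using inj_gs by (auto elim: inj_on_subset)
  moreover have "inj_on (partial_prod G gs) {0..length gs}"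
  proof (rule inj_onI)
    fix i j assume "i \<in> {0..length gs}" "j \<in> {0..length gs}"
      and eq: "partial_prod G gs i = partial_prod G gs j"
    then have ij: "i \<le> N - 1" "j \<le> N - 1" by (simp_all add: gs_def)
    \<comment> \<open>Partial products telescope to \<open>inv (v 0) \<otimes> v i\<close>, so they
      are as distinct as the vertices.\<close>
    then have "v i = v j"
      using eq partial_prod_cycle[of v] v by (simp add: gs_def)
    then have "\<sigma> i = \<sigma> j"
      using inj \<sigma>_less by (auto simp: v_def \<sigma>_def inj_on_def)
    then show "i = j"
      using inj_\<sigma> ij \<open>N > 0\<close> by (auto simp: inj_on_def)
  qed
  ultimately show ?thesis
    by (auto simp: has_S_sequencing_def is_S_sequencing_def)
qed

section \<open>The explicit cycle and its quotients\<close>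

definition zigzag :: "nat \<Rightarrow> nat \<Rightarrow> nat" where
  "zigzag l t = (if even t then t div 2 else l - t div 2)"

lemma zigzag_le: "t \<le> Suc l \<Longrightarrow> zigzag l t \<le> l"
  by (auto simp: zigzag_def)

lemma zigzag_surj:
  assumes "a \<le> l"
  obtains t where "t \<le> l" "zigzag l t = a"
proof (cases "2 * a \<le> l")
  case True
  then show ?thesis by (intro that[of "2 * a"]) (auto simp: zigzag_def)
next
  case False
  then show ?thesis using assms
    by (intro that[of "2 * (l - a) + 1"]) (auto simp: zigzag_def)
qed

definition dih_cycle :: "nat \<Rightarrow> nat \<Rightarrow> nat \<times> nat" where
  "dih_cycle n p =
    (if p \<le> n then (zigzag n (n - p), 0)
     else if p < 3 * n - 1 then
       (let q = (p - n) div 2 in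
        if even (p - n) then (2 * n - q, 0) else (q + of_bool (n div 2 \<le> q), 1))
     else (n + zigzag (n - 1) (p - (3 * n - 1)), 1))"

lemma dih_cycle_rotation: "t \<le> n \<Longrightarrow> dih_cycle n (n - t) = (zigzag n t, 0)"
  by (simp add: dih_cycle_def)

text \<open>The alternating stretch includes both joints: \<open>q = 0\<close> here is the identity,
  where the rotation zigzag ends, and \<open>q = n - 1\<close> in the odd case is the start of the
  reflection zigzag.\<close>

lemma dih_cycle_even: "q < n \<Longrightarrow> dih_cycle n (n + 2 * q) = ((2 * n - q) mod (2 * n), 0)"
  by (auto simp: dih_cycle_def zigzag_def)

lemma dih_cycle_odd:
  "q < n \<Longrightarrow> dih_cycle n (Suc (n + 2 * q)) = (q + of_bool (n div 2 \<le> q), 1)"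
  by (cases "q = n - 1") (auto simp: dih_cycle_def zigzag_def)

lemma dih_cycle_reflection:
  "t < n \<Longrightarrow> dih_cycle n (3 * n - 1 + t) = (n + zigzag (n - 1) t, 1)"
  by (auto simp: dih_cycle_def)

lemma dih_cycle_in_carrier:
  assumes "p < 4 * n - 1"
  shows "dih_cycle n p \<in> carrier (dihedral (2 * n))"
proof -
  consider "p \<le> n" | "n < p" "p < 3 * n - 1" | "n < p" "3 * n - 1 \<le> p"
    by linarith
  then show ?thesis
  proof cases
    case 1
    show ?thesis
    proof -
      have "zigzag n (n - p) \<le> n" "n > 0"
        using assms by (auto intro: zigzag_le)
      with 1 show ?thesis
        by (simp add: dih_cycle_def carrier_dihedral)
    qed
  next
    case 2
    define q where "q = (p - n) div 2"
    have "q < n"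
      using 2 by (auto simp: q_def)
    moreover have "q > 0" if "even (p - n)"
      using dvd_imp_le[OF that] 2 by (auto simp: q_def div_greater_zero_iff)
    ultimately show ?thesis
      using 2 by (simp add: dih_cycle_def carrier_dihedral Let_def flip: q_def)
  next
    case 3
    then have "zigzag (n - 1) (p - (3 * n - 1)) \<le> n - 1"
      using assms by (intro zigzag_le) linarith
    then show ?thesis
      using 3 assms by (simp add: dih_cycle_def carrier_dihedral)
  qed
qed

lemma mod_eq_if_eq_add_nat:
  fixes x y m :: nat
  assumes "x = y \<or> x = y + m" "y < m"
  shows "x mod m = y"
  using assms by auto

text \<open>There are as many positions as elements to hit, so this will also yield
  injectivity.\<close>

lemma dih_cycle_surj:
  assumes "n > 0"
  shows "carrier (dihedral (2 * n)) - {(n div 2, 1)} \<subseteq> dih_cycle n ` {..<4 * n - 1}"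
proof
  fix x assume "x \<in> carrier (dihedral (2 * n)) - {(n div 2, 1)}"
  then obtain a b where x: "x = (a, b)" "a < 2 * n" "b = 0 \<or> b = 1 \<and> a \<noteq> n div 2"
    by (cases x) (auto simp: carrier_dihedral less_2_cases_iff)
  have "\<exists>p<4 * n - 1. dih_cycle n p = x"
  proof (cases "b = 0")
    case True
    show ?thesis
    proof (cases "a \<le> n")
      case True
      then obtain t where "t \<le> n" "zigzag n t = a" by (rule zigzag_surj)
      then show ?thesis using \<open>b = 0\<close> x assms
        by (intro exI[of _ "n - t"]) (auto simp: dih_cycle_rotation)
    next
      case False
      then show ?thesis using \<open>b = 0\<close> x
        by (intro exI[of _ "n + 2 * (2 * n - a)"]) (auto simp: dih_cycle_even)
    qed
  next
    case False
    show ?thesis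
    proof (cases "a < n")
      case True
      \<comment> \<open>Subtracting \<open>of_bool\<close> undoes the shift past the skipped
        exponent.\<close>
      with x False show ?thesis
        by (intro exI[of _ "n + 2 * (a - of_bool (n div 2 < a)) + 1"]) (auto simp: dih_cycle_odd)
    next
      case nle: False
      then have "a - n \<le> n - 1" using x by simp
      then obtain t where "t \<le> n - 1" "zigzag (n - 1) t = a - n" by (rule zigzag_surj)
      then show ?thesis using nle False x assms dih_cycle_reflection[of t n]
        by (intro exI[of _ "3 * n - 1 + t"]) auto
    qed
  qed
  then show "x \<in> dih_cycle n ` {..<4 * n - 1}" by auto
qed

text \<open>Zigzag steps shrink by one and alternate in sign. Modulo \<open>2 * n\<close> the
  rotation zigzag, run backwards, yields n, n-1, n+2, n-3, ...; the reflection zigzag yields n+1,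
  n-2, n+3, ..., since right multiplication by \<open>u^c\<close> lowers a reflection's
  exponent.\<close>

lemma dih_cycle_quotients_rotation:
  assumes "0 < c" "c < 2 * n"
  shows "\<exists>p<4 * n - 1.
    dih_cycle n p \<otimes>\<^bsub>dihedral (2 * n)\<^esub> (c, 0) = dih_cycle n (Suc p mod (4 * n - 1))"
proof -
  \<comment> \<open>The second alternative in \<open>rot\<close> and \<open>refl\<close> is the
    wrap-around modulo \<open>2 * n\<close>.\<close>
  have rot: ?thesis
    if "t < n" "zigzag n (Suc t) + c = zigzag n t \<or> zigzag n (Suc t) + c = zigzag n t + 2 * n" for t
    using that zigzag_le[of t n] mod_eq_if_eq_add_nat[OF that(2)]
      dih_cycle_rotation[of "Suc t" n] dih_cycle_rotation[of t n]
    by (intro exI[of _ "n - Suc t"]) (auto simp: mult_dihedral Suc_diff_Suc)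
  have refl: ?thesis
    if "Suc t < n" "n + zigzag (n - 1) t + (2 * n - c) = n + zigzag (n - 1) (Suc t) \<or>
      n + zigzag (n - 1) t + (2 * n - c) = n + zigzag (n - 1) (Suc t) + 2 * n" for t
    using that zigzag_le[of "Suc t" "n - 1"] mod_eq_if_eq_add_nat[OF that(2)]
      dih_cycle_reflection[of "Suc t" n] dih_cycle_reflection[of t n]
    by (intro exI[of _ "3 * n - 1 + t"]) (auto simp: mult_dihedral)
  consider k where "c = n + 2 * k" | k where "c = n + 2 * k + 1"
    | k where "n = c + 2 * k + 1" | k where "n = c + 2 * k + 2"
  proof (cases "n \<le> c")
    case True
    then obtain d where d: "c = n + d" by (auto simp: le_iff_add)
    then show ?thesis using that(1,2) by (cases "even d") (auto elim!: evenE oddE)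
  next
    case False
    then obtain d where d: "n = c + Suc d" by (metis less_iff_Suc_add not_le add_Suc_right)
    then show ?thesis using that(3,4) by (cases "even d") (auto elim!: evenE oddE)
  qed
  then show ?thesis
  proof cases
    case 1
    then show ?thesis using assms by (intro rot[of "2 * k"]) (auto simp: zigzag_def)
  next
    case 2
    then show ?thesis using assms by (intro refl[of "2 * k"]) (auto simp: zigzag_def)
  next
    case 3
    then show ?thesis using assms by (intro rot[of "2 * k + 1"]) (auto simp: zigzag_def)
  next
    case 4
    then show ?thesis using assms by (intro refl[of "2 * k + 1"]) (auto simp: zigzag_def)
  qed
qed

lemma dih_cycle_quotients_reflection:
  assumes "c < 2 * n"
  shows "\<exists>p<4 * n - 1.
    dih_cycle n p \<otimes>\<^bsub>dihedral (2 * n)\<^esub> (c, 1) = dih_cycle n (Suc p mod (4 * n - 1))"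
proof -
  define h where "h = n div 2"
  \<comment> \<open>\<open>even\<close> treats steps from a rotation to a reflection,
    \<open>odd\<close> those back; together they give every exponent but
    \<open>2 * h\<close>.\<close>
  have even: ?thesis if "q < n" "c = 2 * q + of_bool (h \<le> q)" for q
  proof -
    have "(2 * n - q + c) mod (2 * n) = q + of_bool (h \<le> q)"
      using that by (intro mod_eq_if_eq_add_nat) auto
    then show ?thesis
      using that dih_cycle_even[of q n] dih_cycle_odd[of q n]
      by (intro exI[of _ "n + 2 * q"]) (simp_all add: mult_dihedral h_def mod_simps)
  qed
  have odd: ?thesis if "Suc q < n" "c = 2 * q + 1 + of_bool (h \<le> q)" for q
  proof -
    have "q + of_bool (h \<le> q) + (2 * n - c) = 2 * n - Suc q"
      using that by auto
    then show ?thesis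
      using that dih_cycle_odd[of q n] dih_cycle_even[of "Suc q" n]
      by (intro exI[of _ "n + 2 * q + 1"]) (simp_all add: mult_dihedral h_def)
  qed
  have closing: ?thesis if "c = 2 * h"
  proof -
    \<comment> \<open>The last and first exponents are 3h and h if n = 2h, and 3h+1 and h+1 if n =
      2h+1.\<close>
    have "n + zigzag (n - 1) (n - 1) = zigzag n n + 2 * h"
      using assms by (cases "even n") (auto simp: h_def zigzag_def elim!: evenE oddE)
    moreover define p where "p = 3 * n - 1 + (n - 1)"
    moreover have "Suc p = 4 * n - 1" "n > 0"
      using assms by (auto simp: p_def)
    moreover from this have "dih_cycle n (Suc p mod (4 * n - 1)) = (zigzag n n, 0)"
      using dih_cycle_rotation[of n n] by simp
    ultimately show ?thesis
      using that assms dih_cycle_reflection[of "n - 1" n] zigzag_le[of n n]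
      by (intro exI[of _ p]) (auto simp: mult_dihedral)
  qed
  \<comment> \<open>Beyond \<open>2 * h\<close> the shift swaps parities: odd \<open>c\<close> now
    occur on leaving a rotation, even \<open>c\<close> on leaving a reflection.\<close>
  consider q where "c = 2 * q" "q < h" | "c = 2 * h" | q where "c = 2 * q + 1" "h \<le> q"
    | q where "c = 2 * q + 1" "q < h" | q where "c = 2 * q + 2" "h \<le> q"
  proof (cases "even c")
    case True
    then obtain k where k: "c = 2 * k" ..
    then show ?thesis
      using that(1)[of k] that(2) that(5)[of "k - 1"] by (cases k h rule: linorder_cases) auto
  next
    case False
    then obtain k where "c = 2 * k + 1" ..
    then show ?thesis
      using that(3,4)[of k] by (cases "k < h") auto
  qed
  then show ?thesis
  proof cases
    case (1 q) then show ?thesis using assms by (intro even[of q]) auto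
  next
    case 2 then show ?thesis by (rule closing)
  next
    case (3 q) then show ?thesis using assms by (intro even[of q]) auto
  next
    case (4 q) then show ?thesis using assms by (intro odd[of q]) (auto simp: h_def)
  next
    case (5 q) then show ?thesis using assms by (intro odd[of q]) auto
  qed
qed

theorem theorem4p3:
  fixes m :: nat and S :: "(nat \<times> nat) set"
  assumes "m > 0" and "even m"
    and "S \<subseteq> carrier (dihedral m) - {\<one>\<^bsub>dihedral m\<^esub>}"
    and "card S = 2 * m - 2"
  shows "has_S_sequencing (dihedral m) S"
proof -
  obtain n where m: "m = 2 * n" using \<open>even m\<close> by blast
  then have "n > 0" using \<open>m > 0\<close> by simp
  let ?D = "dihedral m" and ?N = "4 * n - 1"
  interpret group ?D using \<open>m > 0\<close> by (rule group_dihedral)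
  have fin: "finite (carrier ?D)" and card: "card (carrier ?D) = 4 * n"
    by (simp_all add: carrier_dihedral m)
  have "card (carrier ?D - {(n div 2, 1)}) = ?N"
    using \<open>n > 0\<close> fin card by (subst card_Diff_singleton) (auto simp: carrier_dihedral m)
  \<comment> \<open>\<open>?N\<close> positions reach at least \<open>?N\<close> vertices, so none
    is repeated.\<close>
  then have "?N \<le> card (dih_cycle n ` {..<?N})"
    using card_mono[OF _ dih_cycle_surj[OF \<open>n > 0\<close>]] m by simp
  then have inj: "inj_on (dih_cycle n) {..<?N}"
    using card_image_le[of "{..<?N}" "dih_cycle n"] by (intro eq_card_imp_inj_on) auto
  have carrier: "dih_cycle n p \<in> carrier ?D" if "p < ?N" for p
    using dih_cycle_in_carrier[OF that] m by simp
  have surj: "carrier ?D - {\<one>\<^bsub>?D\<^esub>} \<subseteq> cycle_step ?D ?N (dih_cycle n) ` {..<?N}"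
  proof
    fix g assume g: "g \<in> carrier ?D - {\<one>\<^bsub>?D\<^esub>}"
    then obtain c d where "g = (c, d)" "c < 2 * n" "d = 0 \<and> c > 0 \<or> d = 1"
      by (cases g) (auto simp: carrier_dihedral one_dihedral m less_2_cases_iff)
    then obtain p where p: "p < ?N" "dih_cycle n p \<otimes>\<^bsub>?D\<^esub> g = dih_cycle n (Suc p mod ?N)"
      using dih_cycle_quotients_rotation dih_cycle_quotients_reflection m by metis
    have "cycle_step ?D ?N (dih_cycle n) p = g"
    proof -
      have "inv\<^bsub>?D\<^esub> dih_cycle n p \<otimes>\<^bsub>?D\<^esub> (dih_cycle n p \<otimes>\<^bsub>?D\<^esub> g) = g"
        using g carrier[OF p(1)] by (simp flip: m_assoc)
      then show ?thesis by (simp only: cycle_step_def p mod_less)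
    qed
    with p show "g \<in> cycle_step ?D ?N (dih_cycle n) ` {..<?N}" by auto
  qed
  show ?thesis
    by (rule has_S_sequencing_if_R_sequencing[OF fin _ carrier inj surj assms(3)])
      (use card assms(4) \<open>n > 0\<close> m in auto)
qed

end
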